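(* Let $\mathcal{F}\subseteq\mathcal{P}(\mathbb{N})$ be a translation invariant family with the Ramsey property and let $A\subseteq\mathbb{N}$. Then the following statements are equivalent. (a) $A$ is an essential $\mathcal{F}$ set. (b) There is a non-empty set $T$ of functions such that: (i) for all $f\in T$, $\mathrm{dom}(f)\in\omega$ and $\mathrm{range}(f)\subseteq A$; (ii) for all $f\in T$ and all $x\in B_f(T)$, $B_{f^{\frown}x}(T)\subseteq -x+B_f(T)$; (iii) for every finite non-empty subset $F$ of $T$, $\bigcap_{f\in F}B_f(T)\in\mathcal{F}$. (c) There is a downward directed family $\langle C_F\rangle_{F\in I}$ of subsets of $A$ such that: (i) for each $F\in I$ and each $x\in C_F$ there exists $G\in I$ with $C_G\subseteq -x+C_F$; (ii) for every finite non-empty subset $\mathcal{G}$ of $I$, $\bigcap_{F\in\mathcal{G}}C_F\in\mathcal{F}$. (d) There is a decreasing sequence $\langle C_n\rangle_{n=1}^{\infty}$ of subsets of $A$ such that: (i) for each $n\in\mathbb{N}$ and each $x\in C_n$ there exists $m\in\mathbb{N}$ with $C_m\subseteq -x+C_n$; (ii) for each $n\in\mathbb{N}$, $C_n\in\mathcal{F}$.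
   Context: $\mathbb{N}=\{1,2,3,\dots\}$. A family is a non-empty collection $\mathcal{F}\subseteq\mathcal{P}(\mathbb{N})$ that is upward hereditary (if $A\in\mathcal{F}$ and $A\subseteq B\subseteq\mathbb{N}$ then $B\in\mathcal{F}$); families are taken to be proper, i.e. $\emptyset\notin\mathcal{F}$. $\mathcal{F}$ has the Ramsey property if whenever $A\in\mathcal{F}$ and $A=A_1\cup A_2$, some $A_i\in\mathcal{F}$. For $x\in\mathbb{N}$, $A\subseteq\mathbb{N}$: $-x+A=\{y\in\mathbb{N}:x+y\in A\}$ and $x+A=\{x+a:a\in A\}$. $\mathcal{F}$ is translation invariant if $A\in\mathcal{F}$ and $n\in\mathbb{N}$ imply $n+A\in\mathcal{F}$ and $-n+A\in\mathcal{F}$. $\beta\mathbb{N}$ is the set of ultrafilters on $\mathbb{N}$ (points of $\mathbb{N}$ being identified with principal ultrafilters), topologized with basis $\{\overline{A}:A\subseteq\mathbb{N}\}$, $\overline{A}=\{p\in\beta\mathbb{N}:A\in p\}$, with the operation: $A\in p+q$ iff $\{x\in\mathbb{N}:-x+A\in q\}\in p$. Let $\beta(\mathcal{F})=\{p\in\beta\mathbb{N}:p\subseteq\mathcal{F}\}$. A set $A\subseteq\mathbb{N}$ is an essential $\mathcal{F}$ set if $A\in p$ for some idempotent $p=p+p$ in $\beta(\mathcal{F})$. $\omega$ is the first infinite ordinal, and each ordinal is the set of its predecessors, so $0=\emptyset$ and $n=\{0,1,\dots,n-1\}$. If $f$ is a function with $\mathrm{dom}(f)=n\in\omega$, then $f^{\frown}x=f\cup\{(n,x)\}$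 for any $x$. If $T$ is a set of functions whose domains are members of $\omega$ and $f\in T$, then $B_f(T)=\{x:f^{\frown}x\in T\}$. *)

theory Defs
  imports "HOL-Library.Infinite_Typeclass"
begin

text \<open>
  The ground set \<open>{1, 2, 3, \<dots>}\<close> is the subset \<open>NN\<close> of the type \<^typ>\<open>nat\<close>.
\<close>

abbreviation NN :: "nat set" where
  "NN \<equiv> {1..}"

definition family :: "nat set set \<Rightarrow> bool" where
  "family \<F> \<longleftrightarrow>
     \<F> \<subseteq> Pow NN \<and> \<F> \<noteq> {} \<and> {} \<notin> \<F> \<and>
     (\<forall>A B. A \<in> \<F> \<and> A \<subseteq> B \<and> B \<subseteq> NN \<longrightarrow> B \<in> \<F>)"

definition ramsey_property :: "nat set set \<Rightarrow> bool" where
  "ramsey_property \<F> \<longleftrightarrow>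
     (\<forall>A A1 A2. A \<in> \<F> \<and> A = A1 \<union> A2 \<longrightarrow> A1 \<in> \<F> \<or> A2 \<in> \<F>)"

definition left_shift :: "nat \<Rightarrow> nat set \<Rightarrow> nat set" where
  "left_shift x A = {y \<in> NN. x + y \<in> A}"

definition right_shift :: "nat \<Rightarrow> nat set \<Rightarrow> nat set" where
  "right_shift x A = {x + a | a. a \<in> A}"

definition translation_invariant :: "nat set set \<Rightarrow> bool" where
  "translation_invariant \<F> \<longleftrightarrow>
     (\<forall>A\<in>\<F>. \<forall>n\<in>NN. right_shift n A \<in> \<F> \<and> left_shift n A \<in> \<F>)"

definition beta_NN :: "nat set set set" where
  "beta_NN =
     {p. p \<subseteq> Pow NN \<and> NN \<in> p \<and> {} \<notin> p \<and>
         (\<forall>A B. A \<in> p \<and> A \<subseteq> B \<and> B \<subseteq> NN \<longrightarrow> B \<in> p) \<and>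
         (\<forall>A B. A \<in> p \<and> B \<in> p \<longrightarrow> A \<inter> B \<in> p) \<and>
         (\<forall>A. A \<subseteq> NN \<longrightarrow> A \<in> p \<or> NN - A \<in> p)}"

definition beta_plus :: "nat set set \<Rightarrow> nat set set \<Rightarrow> nat set set" where
  "beta_plus p q = {A. A \<subseteq> NN \<and> {x \<in> NN. left_shift x A \<in> q} \<in> p}"

definition beta_family :: "nat set set \<Rightarrow> nat set set set" where
  "beta_family \<F> = {p \<in> beta_NN. p \<subseteq> \<F>}"

definition essential_set :: "nat set set \<Rightarrow> nat set \<Rightarrow> bool" where
  "essential_set \<F> A \<longleftrightarrow> (\<exists>p \<in> beta_family \<F>. p = beta_plus p p \<and> A \<in> p)"

text \<open>
  A function whose domain is the ordinal \<open>n = {0, \<dots>, n - 1}\<close> is a partial function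
  \<open>f :: nat \<rightharpoonup> nat\<close> with \<open>dom f = {..<n}\<close>. For such \<open>f\<close> one has \<open>card (dom f) = n\<close>,
  so \<open>extend f x\<close> is the function \<open>f \<union> {(n, x)}\<close>.
\<close>

definition extend :: "(nat \<rightharpoonup> nat) \<Rightarrow> nat \<Rightarrow> (nat \<rightharpoonup> nat)" where
  "extend f x = f(card (dom f) \<mapsto> x)"

definition successors :: "(nat \<rightharpoonup> nat) set \<Rightarrow> (nat \<rightharpoonup> nat) \<Rightarrow> nat set" where
  "successors T f = {x. extend f x \<in> T}"

text \<open>
  As usual for directed families, the index set is required to be non-empty.
\<close>

definition downward_directed :: "'i set \<Rightarrow> ('i \<Rightarrow> 'a set) \<Rightarrow> bool" where
  "downward_directed I C \<longleftrightarrow>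
     I \<noteq> {} \<and> (\<forall>F\<in>I. \<forall>G\<in>I. \<exists>H\<in>I. C H \<subseteq> C F \<inter> C G)"

text \<open>
  HOL has no existential quantifier over types, so a statement ``there is a family
  indexed by some set'' has to name the type of the indices. The theorem about essential
  sets therefore takes the index set \<open>I\<close> in an arbitrary infinite type \<open>'i\<close>, a type variable
  of class \<^class>\<open>infinite\<close>, and asserts the equivalence for each such type. Index
  sets in a finite type are covered too, since every type embeds in an infinite one;
  infinitude is only there to leave room for the family whose existence is claimed.
\<close>

end

theory Submission
  imports Defs
begin

text \<open>
  A decreasing sequence as in (d), a directed family as in (c), and the finite intersections of the
  sets \<open>B_f(T)\<close> in (b) are all instances of one object: a non-empty, downward directed set \<open>\<C>\<close> of
  members of \<open>\<F>\<close> such that every \<open>C \<in> \<C>\<close> and \<open>x \<in> C\<close> admit a \<open>D \<in> \<C>\<close> with \<open>D \<subseteq> -x + C\<close>.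
  For such a \<open>\<C>\<close>, the ultrafilters \<open>p\<close> with \<open>\<C> \<subseteq> p \<subseteq> \<F>\<close> form a closed subset of \<open>\<beta>\<nat>\<close>. It is non-empty by
  the Ramsey property, and it is closed under addition: the condition on shifts keeps \<open>\<C>\<close> inside
  \<open>p + q\<close>, and translation invariance keeps \<open>p + q\<close> inside \<open>\<F>\<close>. By the theorem of Ellis this
  compact right topological semigroup contains an idempotent, and since the members of \<open>\<C>\<close> are
  subsets of \<open>A\<close>, the set \<open>A\<close> is essential (lemma \<open>essential_set_if_shift_directed\<close>).

  Conversely, if \<open>A\<close> belongs to an idempotent \<open>p \<subseteq> \<F>\<close>, then \<open>D = {x \<in> A. -x + A \<in> p}\<close> is a member of \<open>p\<close>
  all of whose shifts \<open>-x + D\<close> with \<open>x \<in> D\<close> belong to \<open>p\<close>. Intersecting \<open>D\<close> with finitely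
  many of these shifts yields the sequence in (d). Shrinking \<open>D\<close> to \<open>D \<inter> (-x + D)\<close> preserves the
  property, so iterating this along a finite sequence of choices \<open>x\<close> yields the tree in (b).

  The theorem of Ellis is proved here without topology. The closed subsets of \<open>\<beta>\<nat>\<close> are the sets of
  ultrafilters containing a given collection of sets, so a minimal closed subsemigroup is given
  by a maximal collection, and compactness is the existence of an ultrafilter
  above any collection with the finite intersection property.
\<close>

section \<open>Shifts\<close>

lemma left_shift_left_shift: "left_shift x (left_shift y A) = left_shift (y + x) A"
  by (auto simp: left_shift_def add.assoc)

lemma left_shift_Int: "left_shift x (A \<inter> B) = left_shift x A \<inter> left_shift x B"
  by (auto simp: left_shift_def)

lemma left_shift_mono: "A \<subseteq> B \<Longrightarrow> left_shift x A \<subseteq> left_shift x B"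
  by (auto simp: left_shift_def)

lemma left_shift_subset_NN: "left_shift x A \<subseteq> NN"
  by (auto simp: left_shift_def)

lemma left_shift_NN [simp]: "left_shift x NN = NN"
  by (auto simp: left_shift_def)

lemma left_shift_empty [simp]: "left_shift x {} = {}"
  by (auto simp: left_shift_def)

lemma left_shift_Compl: "left_shift x (NN - A) = NN - left_shift x A"
  by (auto simp: left_shift_def)

text \<open>
  For fixed \<open>q\<close>, the map \<open>p \<mapsto> p + q\<close> pulls the basic open set of \<open>A\<close> back to the basic open set of
  this set; this is the continuity of right translations.
\<close>

definition shift_trace :: "nat set set \<Rightarrow> nat set \<Rightarrow> nat set" where
  "shift_trace q A = {x \<in> NN. left_shift x A \<in> q}"

lemma shift_trace_subset_NN: "shift_trace q A \<subseteq> NN"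
  by (auto simp: shift_trace_def)

lemma mem_beta_plus_iff: "A \<in> beta_plus p q \<longleftrightarrow> A \<subseteq> NN \<and> shift_trace q A \<in> p"
  by (simp add: beta_plus_def shift_trace_def)

lemma left_shift_shift_trace:
  "left_shift x (shift_trace q A) = shift_trace q (left_shift x A)"
  by (auto simp: shift_trace_def left_shift_left_shift) (auto simp: left_shift_def)

lemma beta_plus_assoc: "beta_plus (beta_plus p q) r = beta_plus p (beta_plus q r)"
proof -
  have "shift_trace q (shift_trace r A) = shift_trace (beta_plus q r) A" for A
    unfolding shift_trace_def[of q "shift_trace r A"] shift_trace_def[of "beta_plus q r"]
      left_shift_shift_trace
    by (simp add: mem_beta_plus_iff left_shift_subset_NN del: One_nat_def)
  then show ?thesis
    using shift_trace_subset_NN by (auto simp: mem_beta_plus_iff)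
qed

section \<open>Ultrafilters and compactness\<close>

lemma beta_NN_upward: "p \<in> beta_NN \<Longrightarrow> A \<in> p \<Longrightarrow> A \<subseteq> B \<Longrightarrow> B \<subseteq> NN \<Longrightarrow> B \<in> p"
  unfolding beta_NN_def by blast

lemma beta_NN_Int: "p \<in> beta_NN \<Longrightarrow> A \<in> p \<Longrightarrow> B \<in> p \<Longrightarrow> A \<inter> B \<in> p"
  unfolding beta_NN_def by blast

lemma beta_NN_subset: "p \<in> beta_NN \<Longrightarrow> A \<in> p \<Longrightarrow> A \<subseteq> NN"
  by (auto simp: beta_NN_def)

lemma NN_in_beta_NN: "p \<in> beta_NN \<Longrightarrow> NN \<in> p"
  unfolding beta_NN_def by blast

lemma empty_notin_beta_NN: "p \<in> beta_NN \<Longrightarrow> {} \<notin> p"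
  unfolding beta_NN_def by blast

lemma beta_NN_Compl_iff:
  assumes "p \<in> beta_NN" "A \<subseteq> NN"
  shows "NN - A \<in> p \<longleftrightarrow> A \<notin> p"
proof -
  have "A \<in> p \<or> NN - A \<in> p"
    using assms unfolding beta_NN_def by blast
  moreover have "A \<inter> (NN - A) = {}" by blast
  ultimately show ?thesis
    using beta_NN_Int[OF assms(1)] empty_notin_beta_NN[OF assms(1)] by metis
qed

lemma beta_NN_eqI:
  assumes "p \<in> beta_NN" "q \<in> beta_NN" "p \<subseteq> q"
  shows "p = q"
  using assms beta_NN_Compl_iff beta_NN_subset by blast

lemma beta_NN_Inter:
  assumes "p \<in> beta_NN" "finite \<H>" "\<H> \<subseteq> p"
  shows "NN \<inter> \<Inter>\<H> \<in> p"
  using assms(2,3)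
proof (induction \<H> rule: finite_induct)
  case empty
  then show ?case using NN_in_beta_NN[OF assms(1)] by simp
next
  case (insert H \<H>)
  have "NN \<inter> \<Inter>(insert H \<H>) = H \<inter> (NN \<inter> \<Inter>\<H>)" by blast
  then show ?case using insert beta_NN_Int[OF assms(1)] by simp
qed

lemma beta_plus_in_beta_NN:
  assumes p: "p \<in> beta_NN" and q: "q \<in> beta_NN"
  shows "beta_plus p q \<in> beta_NN"
proof -
  have tr_NN: "shift_trace q NN = NN"
    using NN_in_beta_NN[OF q] by (auto simp: shift_trace_def simp del: One_nat_def)
  have tr_empty: "shift_trace q {} = {}"
    using empty_notin_beta_NN[OF q] by (auto simp: shift_trace_def)
  have tr_Int: "shift_trace q A \<inter> shift_trace q B \<subseteq> shift_trace q (A \<inter> B)" for A B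
    using beta_NN_Int[OF q] by (auto simp: shift_trace_def left_shift_Int)
  have tr_mono: "shift_trace q A \<subseteq> shift_trace q B" if "A \<subseteq> B" for A B
    using beta_NN_upward[OF q _ left_shift_mono[OF that] left_shift_subset_NN]
    by (auto simp: shift_trace_def)
  have tr_Compl: "shift_trace q (NN - A) = NN - shift_trace q A" for A
    using beta_NN_Compl_iff[OF q left_shift_subset_NN]
    by (auto simp: shift_trace_def left_shift_Compl simp del: One_nat_def)
  show ?thesis
    unfolding beta_NN_def mem_Collect_eq
  proof (intro conjI allI impI)
    show "beta_plus p q \<subseteq> Pow NN" by (auto simp: mem_beta_plus_iff)
    show "NN \<in> beta_plus p q" using NN_in_beta_NN[OF p] by (simp add: mem_beta_plus_iff tr_NN del: One_nat_def)
    show "{} \<notin> beta_plus p q"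
      using empty_notin_beta_NN[OF p] by (simp add: mem_beta_plus_iff tr_empty)
  next
    fix A B assume "A \<in> beta_plus p q \<and> A \<subseteq> B \<and> B \<subseteq> NN"
    then show "B \<in> beta_plus p q"
      using beta_NN_upward[OF p _ tr_mono shift_trace_subset_NN]
      by (auto simp: mem_beta_plus_iff)
  next
    fix A B assume AB: "A \<in> beta_plus p q \<and> B \<in> beta_plus p q"
    then have "shift_trace q (A \<inter> B) \<in> p"
      using beta_NN_upward[OF p _ tr_Int shift_trace_subset_NN] beta_NN_Int[OF p]
      by (auto simp: mem_beta_plus_iff)
    then show "A \<inter> B \<in> beta_plus p q" using AB by (auto simp: mem_beta_plus_iff)
  next
    fix A :: "nat set" assume "A \<subseteq> NN"
    then show "A \<in> beta_plus p q \<or> NN - A \<in> beta_plus p q"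
      using beta_NN_Compl_iff[OF p shift_trace_subset_NN]
      by (auto simp: mem_beta_plus_iff tr_Compl simp del: One_nat_def)
  qed
qed

definition fip :: "nat set set \<Rightarrow> bool" where
  "fip \<G> \<longleftrightarrow> (\<forall>\<H>. finite \<H> \<and> \<H> \<subseteq> \<G> \<longrightarrow> NN \<inter> \<Inter>\<H> \<noteq> {})"

text \<open>
  A set that meets every finite intersection of \<open>\<G>\<close> can be added to \<open>\<G>\<close>. This one extension step
  yields each of the closure properties of a maximal collection below.
\<close>

lemma fip_insertI:
  assumes "\<And>\<H>. finite \<H> \<Longrightarrow> \<H> \<subseteq> \<G> \<Longrightarrow> NN \<inter> \<Inter>\<H> \<inter> A \<noteq> {}"
  shows "fip (insert A \<G>)"
  unfolding fip_def
proof (intro allI impI)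
  fix \<H> assume "finite \<H> \<and> \<H> \<subseteq> insert A \<G>"
  then have "NN \<inter> \<Inter>(\<H> - {A}) \<inter> A \<noteq> {}" by (intro assms) auto
  moreover have "NN \<inter> \<Inter>(\<H> - {A}) \<inter> A \<subseteq> NN \<inter> \<Inter>\<H>" by blast
  ultimately show "NN \<inter> \<Inter>\<H> \<noteq> {}" by blast
qed

lemma ultrafilter_above_fip:
  assumes "\<G> \<subseteq> Pow NN" "fip \<G>"
  shows "\<exists>p \<in> beta_NN. \<G> \<subseteq> p"
proof -
  define \<A> where "\<A> = {\<M>. \<M> \<subseteq> Pow NN \<and> fip \<M> \<and> \<G> \<subseteq> \<M>}"
  have "\<exists>M\<in>\<A>. \<forall>X\<in>\<A>. M \<subseteq> X \<longrightarrow> X = M"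
  proof (rule subset_Zorn_nonempty)
    show "\<A> \<noteq> {}" using assms by (auto simp: \<A>_def)
    fix \<C> assume ne: "\<C> \<noteq> {}" and ch: "subset.chain \<A> \<C>"
    have sub: "\<C> \<subseteq> \<A>" using ch by (simp add: subset.chain_def)
    have "fip (\<Union>\<C>)"
      unfolding fip_def
    proof (intro allI impI)
      fix \<H> assume "finite \<H> \<and> \<H> \<subseteq> \<Union>\<C>"
      then obtain \<M> where "\<M> \<in> \<C>" "\<H> \<subseteq> \<M>"
        using finite_subset_Union_chain[OF _ _ ne ch] by metis
      with sub \<open>finite \<H> \<and> _\<close> show "NN \<inter> \<Inter>\<H> \<noteq> {}" unfolding \<A>_def fip_def by blast
    qed
    then show "\<Union>\<C> \<in> \<A>" using ne sub unfolding \<A>_def by blast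
  qed
  then obtain M where "M \<in> \<A>" and max: "\<And>X. X \<in> \<A> \<Longrightarrow> M \<subseteq> X \<Longrightarrow> X = M" by blast
  then have M: "M \<subseteq> Pow NN" "fip M" "\<G> \<subseteq> M" by (auto simp: \<A>_def)
  have addI: "A \<in> M"
    if "A \<subseteq> NN" and "\<And>\<H>. finite \<H> \<Longrightarrow> \<H> \<subseteq> M \<Longrightarrow> NN \<inter> \<Inter>\<H> \<inter> A \<noteq> {}" for A
  proof -
    have "insert A M \<in> \<A>"
      using M that(1) fip_insertI[OF that(2)] by (auto simp: \<A>_def)
    then show ?thesis using max by blast
  qed
  have meet: "NN \<inter> \<Inter>\<H> \<noteq> {}" if "finite \<H>" "\<H> \<subseteq> M" for \<H>
    using M(2) that by (auto simp: fip_def)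
  have "M \<in> beta_NN"
    unfolding beta_NN_def mem_Collect_eq
  proof (intro conjI allI impI)
    show "M \<subseteq> Pow NN" by (fact M)
    show "NN \<in> M" using meet by (intro addI) (auto simp: Int_ac)
    show "{} \<notin> M" using meet[of "{{}}"] by auto
  next
    fix A B assume AB: "A \<in> M \<and> A \<subseteq> B \<and> B \<subseteq> NN"
    show "B \<in> M"
    proof (rule addI)
      fix \<H> assume "finite \<H>" "\<H> \<subseteq> M"
      then show "NN \<inter> \<Inter>\<H> \<inter> B \<noteq> {}" using meet[of "insert A \<H>"] AB by auto
    qed (use AB in blast)
  next
    fix A B assume AB: "A \<in> M \<and> B \<in> M"
    show "A \<inter> B \<in> M"
    proof (rule addI)
      fix \<H> assume "finite \<H>" "\<H> \<subseteq> M"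
      then show "NN \<inter> \<Inter>\<H> \<inter> (A \<inter> B) \<noteq> {}" using meet[of "insert A (insert B \<H>)"] AB by auto
    qed (use AB M in blast)
  next
    fix A :: "nat set" assume A: "A \<subseteq> NN"
    show "A \<in> M \<or> NN - A \<in> M"
    proof (rule ccontr)
      assume neg: "\<not> (A \<in> M \<or> NN - A \<in> M)"
      obtain \<H> where H: "finite \<H>" "\<H> \<subseteq> M" "NN \<inter> \<Inter>\<H> \<inter> A = {}"
        using addI[of A] A neg by blast
      obtain \<K> where K: "finite \<K>" "\<K> \<subseteq> M" "NN \<inter> \<Inter>\<K> \<inter> (NN - A) = {}"
        using addI[of "NN - A"] neg by blast
      have "NN \<inter> \<Inter>(\<H> \<union> \<K>) = {}" using H(3) K(3) by blast
      then show False using meet[of "\<H> \<union> \<K>"] H K by blast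
    qed
  qed
  then show ?thesis using M(3) by blast
qed

text \<open>The sets of this form are the closed subsets of \<open>\<beta>\<nat>\<close>.\<close>

definition ultrafilters_above :: "nat set set \<Rightarrow> nat set set set" where
  "ultrafilters_above \<G> = {p \<in> beta_NN. \<G> \<subseteq> p}"

lemma ultrafilters_above_compact:
  assumes "\<And>\<H>. finite \<H> \<Longrightarrow> \<H> \<subseteq> \<G> \<Longrightarrow> ultrafilters_above \<H> \<noteq> {}"
  shows "ultrafilters_above \<G> \<noteq> {}"
proof -
  have "\<G> \<subseteq> Pow NN"
  proof
    fix A assume "A \<in> \<G>"
    then have "ultrafilters_above {A} \<noteq> {}" by (intro assms) auto
    then show "A \<in> Pow NN" using beta_NN_subset by (auto simp: ultrafilters_above_def)
  qed
  moreover have "fip \<G>"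
    unfolding fip_def
  proof (intro allI impI)
    fix \<H> assume H: "finite \<H> \<and> \<H> \<subseteq> \<G>"
    then obtain p where p: "p \<in> beta_NN" "\<H> \<subseteq> p"
      using assms by (force simp: ultrafilters_above_def)
    then show "NN \<inter> \<Inter>\<H> \<noteq> {}"
      using beta_NN_Inter[of p \<H>] empty_notin_beta_NN[of p] H by force
  qed
  ultimately show ?thesis
    using ultrafilter_above_fip unfolding ultrafilters_above_def by blast
qed

section \<open>Idempotents in closed subsemigroups\<close>

text \<open>
  Right translation by \<open>p\<close> is continuous, so the image of a closed set \<open>S\<close> is closed. Hence a
  \<open>q\<close> such that every member of \<open>q\<close> lies in some \<open>r + p\<close> with \<open>r \<in> S\<close> is itself such a sum: an \<open>r\<close> with
  \<open>r + p = q\<close> has to contain the sets \<open>shift_trace p B\<close> with \<open>B \<in> q\<close>, and by compactness this can be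
  arranged if it can be arranged for the intersection \<open>B\<close> of finitely many members of \<open>q\<close>.
\<close>

lemma right_translate_closed:
  assumes p: "p \<in> beta_NN" and q: "q \<in> beta_NN"
    and approx: "\<And>B. B \<in> q \<Longrightarrow> \<exists>r \<in> ultrafilters_above \<G>. B \<in> beta_plus r p"
  shows "\<exists>r \<in> ultrafilters_above \<G>. beta_plus r p = q"
proof -
  have "ultrafilters_above (\<G> \<union> shift_trace p ` q) \<noteq> {}"
  proof (rule ultrafilters_above_compact)
    fix \<H> assume H: "finite \<H>" "\<H> \<subseteq> \<G> \<union> shift_trace p ` q"
    then have "finite (\<H> - \<G>)" "\<H> - \<G> \<subseteq> shift_trace p ` q" by auto
    then obtain \<B> where B: "\<B> \<subseteq> q" "finite \<B>" "\<H> - \<G> = shift_trace p ` \<B>"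
      using finite_subset_image[of "\<H> - \<G>" "shift_trace p" q] by metis
    obtain r where r: "r \<in> ultrafilters_above \<G>" "NN \<inter> \<Inter>\<B> \<in> beta_plus r p"
      using approx beta_NN_Inter[OF q B(2,1)] by blast
    then have r': "r \<in> beta_NN" "\<G> \<subseteq> r" by (auto simp: ultrafilters_above_def)
    have "shift_trace p b \<in> r" if "b \<in> \<B>" for b
    proof -
      have "b \<in> beta_plus r p"
      proof (rule beta_NN_upward[OF beta_plus_in_beta_NN[OF r'(1) p] r(2)])
        show "NN \<inter> \<Inter>\<B> \<subseteq> b" using that by blast
        show "b \<subseteq> NN" by (rule beta_NN_subset[OF q]) (use that B(1) in blast)
      qed
      then show ?thesis by (simp add: mem_beta_plus_iff)
    qed
    then have "\<H> - \<G> \<subseteq> r" unfolding B(3) by (rule image_subsetI)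
    then have "\<H> \<subseteq> r" using r'(2) by blast
    then show "ultrafilters_above \<H> \<noteq> {}" using r'(1) by (auto simp: ultrafilters_above_def)
  qed
  then obtain r where r: "r \<in> ultrafilters_above \<G>" "shift_trace p ` q \<subseteq> r"
    by (auto simp: ultrafilters_above_def)
  then have "q \<subseteq> beta_plus r p"
    using beta_NN_subset[OF q] by (auto simp: mem_beta_plus_iff)
  moreover have "r \<in> beta_NN" using r(1) by (simp add: ultrafilters_above_def)
  ultimately show ?thesis
    using r(1) beta_NN_eqI[OF q beta_plus_in_beta_NN[OF _ p]] by blast
qed

text \<open>
  This is the theorem of Ellis. A minimal non-empty closed subsemigroup \<open>S\<close>
  exists by compactness. For \<open>p \<in> S\<close>, both \<open>S + p\<close> and, once \<open>p \<in> S + p\<close> is known,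
  \<open>{r \<in> S. r + p = p}\<close> are non-empty closed subsemigroups of \<open>S\<close>, hence equal to \<open>S\<close>; so \<open>p + p = p\<close>.
\<close>

lemma idempotent_in_closed_subsemigroup:
  assumes ne: "ultrafilters_above \<G> \<noteq> {}"
    and sg: "\<And>p q. p \<in> ultrafilters_above \<G> \<Longrightarrow> q \<in> ultrafilters_above \<G> \<Longrightarrow>
               beta_plus p q \<in> ultrafilters_above \<G>"
  shows "\<exists>p \<in> ultrafilters_above \<G>. p = beta_plus p p"
proof -
  define \<A> where "\<A> = {\<M>. \<G> \<subseteq> \<M> \<and> ultrafilters_above \<M> \<noteq> {} \<and>
    (\<forall>p \<in> ultrafilters_above \<M>. \<forall>q \<in> ultrafilters_above \<M>. beta_plus p q \<in> ultrafilters_above \<M>)}"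
  have "\<exists>M\<in>\<A>. \<forall>X\<in>\<A>. M \<subseteq> X \<longrightarrow> X = M"
  proof (rule subset_Zorn_nonempty)
    show "\<A> \<noteq> {}" using ne sg by (auto simp: \<A>_def)
    fix \<C> assume nC: "\<C> \<noteq> {}" and ch: "subset.chain \<A> \<C>"
    have sub: "\<C> \<subseteq> \<A>" using ch by (simp add: subset.chain_def)
    have "ultrafilters_above (\<Union>\<C>) \<noteq> {}"
    proof (rule ultrafilters_above_compact)
      fix \<H> assume "finite \<H>" "\<H> \<subseteq> \<Union>\<C>"
      then obtain \<M> where "\<M> \<in> \<C>" "\<H> \<subseteq> \<M>"
        using finite_subset_Union_chain[OF _ _ nC ch] by metis
      with sub show "ultrafilters_above \<H> \<noteq> {}"
        unfolding \<A>_def ultrafilters_above_def by blast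
    qed
    moreover have "ultrafilters_above (\<Union>\<C>) = (\<Inter>\<M>\<in>\<C>. ultrafilters_above \<M>)"
      using nC by (auto simp: ultrafilters_above_def)
    moreover have "\<G> \<subseteq> \<Union>\<C>" using nC sub unfolding \<A>_def by blast
    moreover have "beta_plus p q \<in> ultrafilters_above \<M>"
      if "\<M> \<in> \<C>" "p \<in> ultrafilters_above \<M>" "q \<in> ultrafilters_above \<M>" for p q \<M>
      using that sub unfolding \<A>_def by blast
    ultimately show "\<Union>\<C> \<in> \<A>" unfolding \<A>_def by simp
  qed
  then obtain M where MA: "M \<in> \<A>" and max: "\<And>X. X \<in> \<A> \<Longrightarrow> M \<subseteq> X \<Longrightarrow> X = M" by blast
  define S where "S = ultrafilters_above M"
  have GM: "\<G> \<subseteq> M" and plus: "\<And>p q. p \<in> S \<Longrightarrow> q \<in> S \<Longrightarrow> beta_plus p q \<in> S"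
    using MA by (auto simp: \<A>_def S_def)
  have S_beta: "r \<in> beta_NN" "M \<subseteq> r" if "r \<in> S" for r
    using that by (auto simp: S_def ultrafilters_above_def)
  obtain p where p: "p \<in> S" using MA by (auto simp: \<A>_def S_def)
  note pb = S_beta(1)[OF p]

  \<comment> \<open>The largest collection contained in all members of \<open>S + p\<close>; it describes the closed set \<open>S + p\<close>.\<close>
  define M1 where "M1 = \<Inter>((\<lambda>r. beta_plus r p) ` S)"
  have M1: "ultrafilters_above M1 = (\<lambda>r. beta_plus r p) ` S"
  proof
    show "(\<lambda>r. beta_plus r p) ` S \<subseteq> ultrafilters_above M1"
      using beta_plus_in_beta_NN[OF S_beta(1) pb] by (auto simp: ultrafilters_above_def M1_def)
    show "ultrafilters_above M1 \<subseteq> (\<lambda>r. beta_plus r p) ` S"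
    proof
      fix q assume "q \<in> ultrafilters_above M1"
      then have q: "q \<in> beta_NN" "M1 \<subseteq> q" by (auto simp: ultrafilters_above_def)
      have "\<exists>r\<in>S. B \<in> beta_plus r p" if "B \<in> q" for B
      proof (rule ccontr)
        assume "\<not> (\<exists>r\<in>S. B \<in> beta_plus r p)"
        then have "NN - B \<in> M1"
          using beta_NN_Compl_iff[OF beta_plus_in_beta_NN[OF S_beta(1) pb] beta_NN_subset[OF q(1) that]]
          by (auto simp: M1_def)
        then show False
          using q beta_NN_Compl_iff[OF q(1) beta_NN_subset[OF q(1) that]] that by blast
      qed
      then show "q \<in> (\<lambda>r. beta_plus r p) ` S"
        using right_translate_closed[OF pb q(1), of M] by (auto simp: S_def)
    qed
  qed
  have MM1: "M \<subseteq> M1"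
    using S_beta(2)[OF plus[OF _ p]] by (auto simp: M1_def)
  have "M1 \<in> \<A>"
  proof -
    have "beta_plus (beta_plus r p) (beta_plus s p) \<in> (\<lambda>r. beta_plus r p) ` S"
      if "r \<in> S" "s \<in> S" for r s
    proof
      show "beta_plus (beta_plus r p) (beta_plus s p) = beta_plus (beta_plus r (beta_plus p s)) p"
        by (simp add: beta_plus_assoc)
    qed (use that p plus in blast)
    then show ?thesis unfolding \<A>_def using GM MM1 p by (auto simp: M1)
  qed
  then have "M1 = M" using max MM1 by blast
  then have "p \<in> (\<lambda>r. beta_plus r p) ` S" using p M1 by (simp add: S_def)
  then obtain r0 where r0: "r0 \<in> S" "beta_plus r0 p = p" by force

  \<comment> \<open>This collection describes the stabilizer \<open>{r \<in> S. r + p = p}\<close>.\<close>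
  define M2 where "M2 = M \<union> shift_trace p ` p"
  have M2: "ultrafilters_above M2 = {r \<in> S. beta_plus r p = p}"
  proof -
    have "shift_trace p ` p \<subseteq> r \<longleftrightarrow> beta_plus r p = p" if "r \<in> S" for r
    proof
      assume "shift_trace p ` p \<subseteq> r"
      then have "p \<subseteq> beta_plus r p"
        using beta_NN_subset[OF pb] by (auto simp: mem_beta_plus_iff)
      then show "beta_plus r p = p"
        using beta_NN_eqI[OF pb beta_plus_in_beta_NN[OF S_beta(1)[OF that] pb]] by simp
    next
      assume "beta_plus r p = p"
      then show "shift_trace p ` p \<subseteq> r" using mem_beta_plus_iff[of _ r p] by auto
    qed
    then show ?thesis by (auto simp: M2_def S_def ultrafilters_above_def)
  qed
  have "M2 \<in> \<A>"
    unfolding \<A>_def using GM r0 plus by (auto simp: M2 beta_plus_assoc) (auto simp: M2_def)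
  then have "M2 = M" using max by (auto simp: M2_def)
  then have "beta_plus p p = p" using p M2 by (auto simp: S_def)
  moreover have "p \<in> ultrafilters_above \<G>"
    using S_beta[OF p] GM by (auto simp: ultrafilters_above_def)
  ultimately show ?thesis by auto
qed

section \<open>From shift-directed collections to essential sets\<close>

lemma ramsey_Un_notin:
  assumes "ramsey_property \<F>" "A \<notin> \<F>" "B \<notin> \<F>"
  shows "A \<union> B \<notin> \<F>"
  using assms unfolding ramsey_property_def by blast

text \<open>
  For an ultrafilter \<open>p\<close>, the conditions \<open>\<C> \<subseteq> p\<close> and \<open>p \<subseteq> \<F>\<close> together amount to \<open>\<G> \<subseteq> p\<close> for the filter
  \<open>\<G>\<close> of the sets that contain some \<open>C \<in> \<C>\<close> up to a set outside \<open>\<F>\<close>; the Ramsey property says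
  that the sets outside \<open>\<F>\<close> form an ideal.
\<close>

lemma essential_set_if_shift_directed:
  assumes fam: "family \<F>" and ti: "translation_invariant \<F>" and ram: "ramsey_property \<F>"
    and A: "A \<subseteq> NN"
    and ne: "\<C> \<noteq> {}" and CA: "\<And>C. C \<in> \<C> \<Longrightarrow> C \<subseteq> A" and CF: "\<And>C. C \<in> \<C> \<Longrightarrow> C \<in> \<F>"
    and dir: "\<And>C D. C \<in> \<C> \<Longrightarrow> D \<in> \<C> \<Longrightarrow> \<exists>E\<in>\<C>. E \<subseteq> C \<inter> D"
    and shift: "\<And>C x. C \<in> \<C> \<Longrightarrow> x \<in> C \<Longrightarrow> \<exists>D\<in>\<C>. D \<subseteq> left_shift x C"
  shows "essential_set \<F> A"
proof -
  have up: "Y \<in> \<F>" if "X \<in> \<F>" "X \<subseteq> Y" "Y \<subseteq> NN" for X Y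
    using fam that unfolding family_def by blast
  have F0: "{} \<notin> \<F>" using fam by (simp add: family_def)
  have CN: "C \<subseteq> NN" if "C \<in> \<C>" for C using CA[OF that] A by simp
  define \<G> where "\<G> = {B. B \<subseteq> NN \<and> (\<exists>C\<in>\<C>. C - B \<notin> \<F>)}"
  have G_Int: "B \<inter> B' \<in> \<G>" if BB: "B \<in> \<G>" "B' \<in> \<G>" for B B'
  proof -
    obtain C C' where C: "C \<in> \<C>" "C - B \<notin> \<F>" "C' \<in> \<C>" "C' - B' \<notin> \<F>"
      using BB by (auto simp: \<G>_def)
    obtain E where E: "E \<in> \<C>" "E \<subseteq> C \<inter> C'" using dir C by blast
    have "(C - B) \<union> (C' - B') \<notin> \<F>" using ramsey_Un_notin[OF ram] C by blast
    moreover have "E - (B \<inter> B') \<subseteq> (C - B) \<union> (C' - B')" using E(2) by blast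
    moreover have "(C - B) \<union> (C' - B') \<subseteq> NN" using CN C(1,3) by blast
    ultimately have "E - (B \<inter> B') \<notin> \<F>" using up by blast
    then show ?thesis using E(1) BB by (auto simp: \<G>_def)
  qed
  have G_NN: "NN \<in> \<G>"
  proof -
    obtain C where C: "C \<in> \<C>" using ne by blast
    then have "C - NN = {}" using CN by blast
    then have "C - NN \<notin> \<F>" using F0 by metis
    then show ?thesis using C by (auto simp: \<G>_def)
  qed
  have "NN \<inter> \<Inter>\<H> \<in> \<G>" if "finite \<H>" "\<H> \<subseteq> \<G>" for \<H>
    using that
  proof (induction \<H> rule: finite_induct)
    case empty then show ?case using G_NN by simp
  next
    case (insert H \<H>)
    have "NN \<inter> \<Inter>(insert H \<H>) = H \<inter> (NN \<inter> \<Inter>\<H>)" by blast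
    then show ?case using insert G_Int by simp
  qed
  moreover have "{} \<notin> \<G>" using CF by (auto simp: \<G>_def)
  ultimately have "fip \<G>" unfolding fip_def by metis
  moreover have "\<G> \<subseteq> Pow NN" by (auto simp: \<G>_def)
  ultimately have nonempty: "ultrafilters_above \<G> \<noteq> {}"
    using ultrafilter_above_fip unfolding ultrafilters_above_def by blast
  have above_iff: "p \<in> ultrafilters_above \<G> \<longleftrightarrow> p \<in> beta_NN \<and> \<C> \<subseteq> p \<and> p \<subseteq> \<F>" for p
  proof (intro iffI conjI)
    assume "p \<in> ultrafilters_above \<G>"
    then have p: "p \<in> beta_NN" "\<G> \<subseteq> p" by (auto simp: ultrafilters_above_def)
    show "p \<in> beta_NN" by (fact p)
    have "C \<in> \<G>" if "C \<in> \<C>" for C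
      using CN[OF that] that F0 by (force simp: \<G>_def intro: bexI[of _ C])
    then show "\<C> \<subseteq> p" using p by blast
    show "p \<subseteq> \<F>"
    proof (rule ccontr)
      assume "\<not> p \<subseteq> \<F>"
      then obtain B where B: "B \<in> p" "B \<notin> \<F>" by blast
      have BN: "B \<subseteq> NN" using beta_NN_subset[OF p(1) B(1)] .
      obtain C where C: "C \<in> \<C>" using ne by blast
      have "C - (NN - B) \<notin> \<F>" using up[of "C - (NN - B)" B] B(2) BN CN[OF C] by blast
      then have "NN - B \<in> \<G>" using C by (auto simp: \<G>_def)
      then show False using p B(1) beta_NN_Compl_iff[OF p(1) BN] by blast
    qed
  next
    assume p: "p \<in> beta_NN \<and> \<C> \<subseteq> p \<and> p \<subseteq> \<F>"
    have "B \<in> p" if B: "B \<in> \<G>" for B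
    proof (rule ccontr)
      assume "B \<notin> p"
      moreover have BN: "B \<subseteq> NN" using B by (simp add: \<G>_def)
      ultimately have "NN - B \<in> p" using beta_NN_Compl_iff p by blast
      moreover obtain C where C: "C \<in> \<C>" "C - B \<notin> \<F>" using B by (auto simp: \<G>_def)
      ultimately have "C \<inter> (NN - B) \<in> p" using beta_NN_Int p by blast
      moreover have "C \<inter> (NN - B) = C - B" using CN[OF C(1)] by blast
      ultimately show False using C(2) p by auto
    qed
    then show "p \<in> ultrafilters_above \<G>" using p by (auto simp: ultrafilters_above_def)
  qed
  have semigroup: "beta_plus p q \<in> ultrafilters_above \<G>"
    if "p \<in> ultrafilters_above \<G>" "q \<in> ultrafilters_above \<G>" for p q
  proof -
    have p: "p \<in> beta_NN" "\<C> \<subseteq> p" and q: "q \<in> beta_NN" "\<C> \<subseteq> q" "q \<subseteq> \<F>"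
      using that above_iff by auto
    have "C \<in> beta_plus p q" if C: "C \<in> \<C>" for C
    proof -
      have "C \<subseteq> shift_trace q C"
      proof
        fix x assume x: "x \<in> C"
        obtain D where "D \<in> \<C>" "D \<subseteq> left_shift x C" using shift[OF C x] by blast
        then have "left_shift x C \<in> q"
          using beta_NN_upward[OF q(1)] q(2) left_shift_subset_NN by blast
        then show "x \<in> shift_trace q C" using x CN[OF C] by (auto simp: shift_trace_def)
      qed
      then have "shift_trace q C \<in> p"
        using beta_NN_upward[OF p(1) _ _ shift_trace_subset_NN] p(2) C by blast
      then show ?thesis using CN[OF C] by (simp add: mem_beta_plus_iff)
    qed
    moreover have "B \<in> \<F>" if "B \<in> beta_plus p q" for B
    proof -
      have B: "B \<subseteq> NN" "shift_trace q B \<in> p" using that by (auto simp: mem_beta_plus_iff)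
      then have "shift_trace q B \<noteq> {}" using empty_notin_beta_NN[OF p(1)] by force
      then obtain x where x: "x \<in> NN" "left_shift x B \<in> q" by (auto simp: shift_trace_def)
      then have "right_shift x (left_shift x B) \<in> \<F>"
        using ti q(3) by (auto simp: translation_invariant_def)
      moreover have "right_shift x (left_shift x B) \<subseteq> B"
        by (auto simp: right_shift_def left_shift_def)
      ultimately show ?thesis using up B(1) by blast
    qed
    ultimately show ?thesis using above_iff beta_plus_in_beta_NN[OF p(1) q(1)] by blast
  qed
  obtain p where p: "p \<in> ultrafilters_above \<G>" "p = beta_plus p p"
    using idempotent_in_closed_subsemigroup[OF nonempty semigroup] by blast
  obtain C where "C \<in> \<C>" using ne by blast
  then have "A \<in> p" using beta_NN_upward[of p C A] CA A p(1) above_iff by blast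
  then show ?thesis
    using p above_iff unfolding essential_set_def beta_family_def by blast
qed

section \<open>From idempotents to trees and sequences\<close>

text \<open>
  Idempotence gives \<open>A' = {x. -x + A \<in> p} \<in> p\<close>. With \<open>D = A \<inter> A'\<close> and \<open>x \<in> D\<close>, the set \<open>-x + D\<close> is the
  intersection of \<open>-x + A \<in> p\<close> and \<open>-x + A'\<close>, and the latter is the same construction applied to
  \<open>-x + A\<close>, so it belongs to \<open>p\<close> as well.
\<close>

lemma idempotent_shift_core:
  assumes p: "p \<in> beta_NN" "p = beta_plus p p" and A: "A \<in> p"
  obtains D where "D \<in> p" "D \<subseteq> A" "\<And>x. x \<in> D \<Longrightarrow> left_shift x D \<in> p"
proof
  have trace: "shift_trace p B \<in> p" if "B \<in> p" for B
    using that p(2) mem_beta_plus_iff[of B p p] by simp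
  show "A \<inter> shift_trace p A \<in> p" using beta_NN_Int[OF p(1) A trace[OF A]] .
  fix x assume "x \<in> A \<inter> shift_trace p A"
  then have "left_shift x A \<in> p" by (simp add: shift_trace_def)
  then show "left_shift x (A \<inter> shift_trace p A) \<in> p"
    using beta_NN_Int[OF p(1)] trace by (simp add: left_shift_Int left_shift_shift_trace)
qed simp

text \<open>
  The sets \<open>C_n\<close> collect what is demanded by the elements of \<open>D\<close> up to \<open>n\<close>. If \<open>x \<in> C_n\<close> then \<open>x\<close> and
  all \<open>z + x\<close> with \<open>z \<in> D\<close>, \<open>z \<le> n\<close> are elements of \<open>D\<close> bounded by \<open>n + x\<close>, so \<open>C_(n+x) \<subseteq> -x + C_n\<close>.
\<close>

lemma sequence_of_idempotent:
  assumes p: "p \<in> beta_NN" "p = beta_plus p p" and A: "A \<in> p"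
  obtains C :: "nat \<Rightarrow> nat set" where "antimono_on NN C" "\<And>n. C n \<subseteq> A"
    "\<And>n x. n \<in> NN \<Longrightarrow> x \<in> C n \<Longrightarrow> \<exists>m\<in>NN. C m \<subseteq> left_shift x (C n)" "\<And>n. C n \<in> p"
proof -
  obtain D where D: "D \<in> p" "D \<subseteq> A" "\<And>x. x \<in> D \<Longrightarrow> left_shift x D \<in> p"
    using idempotent_shift_core[OF p A] by blast
  have DN: "D \<subseteq> NN" using beta_NN_subset[OF p(1) D(1)] .
  define C where "C n = {y \<in> D. \<forall>z\<in>D. z \<le> n \<longrightarrow> z + y \<in> D}" for n
  have Cp: "C n \<in> p" for n
  proof -
    define \<H> where "\<H> = insert D ((\<lambda>z. left_shift z D) ` {z \<in> D. z \<le> n})"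
    have "NN \<inter> \<Inter>\<H> \<in> p"
      using D by (intro beta_NN_Inter[OF p(1)]) (auto simp: \<H>_def)
    moreover have "C n = NN \<inter> \<Inter>\<H>"
      using DN by (auto simp: \<H>_def C_def left_shift_def)
    ultimately show ?thesis by simp
  qed
  have "\<exists>m\<in>NN. C m \<subseteq> left_shift x (C n)" if "n \<in> NN" "x \<in> C n" for n x
  proof
    show "n + x \<in> NN" using that by simp
    show "C (n + x) \<subseteq> left_shift x (C n)"
    proof
      fix y assume y: "y \<in> C (n + x)"
      have "z + (x + y) \<in> D" if "z \<in> D" "z \<le> n" for z
      proof -
        have "z + x \<in> D" using that \<open>x \<in> C n\<close> by (simp add: C_def)
        then show ?thesis using y that by (simp add: C_def add.assoc [symmetric])
      qed
      moreover have "x + y \<in> D" using y \<open>x \<in> C n\<close> by (auto simp: C_def)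
      ultimately show "y \<in> left_shift x (C n)" using y DN by (auto simp: left_shift_def C_def)
    qed
  qed
  moreover have "antimono_on NN C" by (intro monotone_onI) (auto simp: C_def)
  moreover have "C n \<subseteq> A" for n using D(2) by (auto simp: C_def)
  ultimately show thesis using Cp by (intro that)
qed

text \<open>What remains of \<open>D\<close> after the choices \<open>f 0, \<dots>, f (n - 1)\<close>.\<close>

primrec residual :: "nat set \<Rightarrow> (nat \<rightharpoonup> nat) \<Rightarrow> nat \<Rightarrow> nat set" where
  "residual D f 0 = D"
| "residual D f (Suc n) = residual D f n \<inter> left_shift (the (f n)) (residual D f n)"

lemma residual_cong: "(\<And>k. k < n \<Longrightarrow> f k = g k) \<Longrightarrow> residual D f n = residual D g n"
  by (induction n) auto

lemma residual_subset: "residual D f n \<subseteq> D"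
  by (induction n) auto

definition residual_tree :: "nat set \<Rightarrow> (nat \<rightharpoonup> nat) set" where
  "residual_tree D = {f. \<exists>n. dom f = {..<n} \<and> (\<forall>k<n. the (f k) \<in> residual D f k)}"

lemma extend_eq: "dom f = {..<n} \<Longrightarrow> extend f x = f(n \<mapsto> x)"
  by (simp add: extend_def)

lemma successors_residual_tree:
  assumes f: "f \<in> residual_tree D" and n: "dom f = {..<n}"
  shows "successors (residual_tree D) f = residual D f n"
proof -
  have f': "\<forall>k<n. the (f k) \<in> residual D f k"
    using f n by (auto simp: residual_tree_def lessThan_eq_iff)
  have same: "residual D (f(n \<mapsto> x)) k = residual D f k" if "k \<le> n" for x k
    using that by (intro residual_cong) auto
  have dom: "dom (f(n \<mapsto> x)) = {..<m} \<longleftrightarrow> m = Suc n" for x m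
    using n by (auto simp: lessThan_Suc[symmetric] lessThan_eq_iff simp del: dom_eq_empty_conv)
  have "f(n \<mapsto> x) \<in> residual_tree D \<longleftrightarrow> x \<in> residual D f n" for x
    unfolding residual_tree_def mem_Collect_eq dom
    using f' by (auto simp: less_Suc_eq same)
  then show ?thesis by (simp add: successors_def extend_eq[OF n])
qed

text \<open>
  If all shifts \<open>-x + D\<close> with \<open>x \<in> D\<close> belong to \<open>p\<close>, the same holds for \<open>D \<inter> (-x + D)\<close>, because an
  element \<open>y\<close> of the latter has \<open>x + y \<in> D\<close>, and \<open>-y + (-x + D) = -(x + y) + D\<close>. Hence no sequence
  of choices leads out of \<open>p\<close>.
\<close>

lemma residual_in_ultrafilter:
  assumes p: "p \<in> beta_NN" and D: "D \<in> p" "\<And>x. x \<in> D \<Longrightarrow> left_shift x D \<in> p"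
    and "\<And>k. k < n \<Longrightarrow> the (f k) \<in> residual D f k"
  shows "residual D f n \<in> p \<and> (\<forall>x\<in>residual D f n. left_shift x (residual D f n) \<in> p)"
  using assms(4)
proof (induction n)
  case 0
  then show ?case using D by simp
next
  case (Suc n)
  let ?R = "residual D f n" and ?a = "the (f n)"
  have IH: "?R \<in> p" "\<And>x. x \<in> ?R \<Longrightarrow> left_shift x ?R \<in> p" using Suc by auto
  have a: "?a \<in> ?R" using Suc.prems by simp
  have "left_shift y (left_shift ?a ?R) \<in> p" if "y \<in> left_shift ?a ?R" for y
    using IH(2)[of "?a + y"] that by (simp add: left_shift_left_shift) (simp add: left_shift_def)
  then show ?case
    using IH a beta_NN_Int[OF p] by (auto simp: left_shift_Int)
qed

lemma tree_of_idempotent: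
  assumes p: "p \<in> beta_NN" "p = beta_plus p p" and A: "A \<in> p"
  obtains T :: "(nat \<rightharpoonup> nat) set" where "T \<noteq> {}"
    "\<And>f. f \<in> T \<Longrightarrow> (\<exists>n. dom f = {..<n}) \<and> ran f \<subseteq> A"
    "\<And>f x. f \<in> T \<Longrightarrow> x \<in> successors T f \<Longrightarrow>
       successors T (extend f x) \<subseteq> left_shift x (successors T f)"
    "\<And>F. finite F \<Longrightarrow> F \<noteq> {} \<Longrightarrow> F \<subseteq> T \<Longrightarrow> (\<Inter>f\<in>F. successors T f) \<in> p"
proof -
  obtain D where D: "D \<in> p" "D \<subseteq> A" "\<And>x. x \<in> D \<Longrightarrow> left_shift x D \<in> p"
    using idempotent_shift_core[OF p A] by blast
  let ?T = "residual_tree D"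
  have "Map.empty \<in> ?T" by (auto simp: residual_tree_def)
  then have "?T \<noteq> {}" by blast
  moreover have "(\<exists>n. dom f = {..<n}) \<and> ran f \<subseteq> A" if f: "f \<in> ?T" for f
  proof -
    obtain n where n: "dom f = {..<n}" "\<forall>k<n. the (f k) \<in> residual D f k"
      using f unfolding residual_tree_def by blast
    have "ran f \<subseteq> A"
    proof
      fix y assume "y \<in> ran f"
      then obtain k where k: "f k = Some y" by (auto simp: ran_def)
      then have "k < n" using n(1) by auto
      then show "y \<in> A" using n(2) k residual_subset D(2) by fastforce
    qed
    then show ?thesis using n(1) by blast
  qed
  moreover have "successors ?T (extend f x) \<subseteq> left_shift x (successors ?T f)"
    if f: "f \<in> ?T" and x: "x \<in> successors ?T f" for f x
  proof -
    obtain n where n: "dom f = {..<n}" using f by (auto simp: residual_tree_def)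
    have fx: "f(n \<mapsto> x) \<in> ?T" using x by (simp add: successors_def extend_eq[OF n])
    have "dom (f(n \<mapsto> x)) = {..<Suc n}" using n by (simp add: lessThan_Suc)
    then have "successors ?T (extend f x) = residual D (f(n \<mapsto> x)) (Suc n)"
      using successors_residual_tree[OF fx] extend_eq[OF n] by simp
    moreover have "residual D (f(n \<mapsto> x)) n = residual D f n" by (intro residual_cong) auto
    ultimately show ?thesis using successors_residual_tree[OF f n] by simp
  qed
  moreover have "(\<Inter>f\<in>F. successors ?T f) \<in> p" if F: "finite F" "F \<noteq> {}" "F \<subseteq> ?T" for F
  proof -
    have "successors ?T f \<in> p" if f: "f \<in> ?T" for f
    proof -
      obtain n where n: "dom f = {..<n}" "\<forall>k<n. the (f k) \<in> residual D f k"
        using f unfolding residual_tree_def by blast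
      then show ?thesis
        using residual_in_ultrafilter[OF p(1) D(1,3), of n f] successors_residual_tree[OF f n(1)]
        by simp
    qed
    then have sub: "successors ?T ` F \<subseteq> p" using F(3) by blast
    then have "NN \<inter> (\<Inter>f\<in>F. successors ?T f) \<in> p" using F(1) by (intro beta_NN_Inter[OF p(1)]) auto
    moreover have "(\<Inter>f\<in>F. successors ?T f) \<subseteq> NN"
      using sub F(2) beta_NN_subset[OF p(1)] by blast
    ultimately show ?thesis by (simp add: Int_absorb1)
  qed
  ultimately show thesis by (intro that)
qed

section \<open>The equivalences\<close>

text \<open>
  The finite intersections of the sets \<open>B_f(T)\<close> form a shift-directed collection: for \<open>x\<close> in the
  intersection over \<open>F\<close>, all \<open>extend f x\<close> with \<open>f \<in> F\<close> belong to \<open>T\<close>, and the intersection over these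
  nodes lies in the shift by \<open>x\<close>.
\<close>

lemma essential_set_of_tree:
  assumes base: "family \<F>" "translation_invariant \<F>" "ramsey_property \<F>" "A \<subseteq> NN"
    and ne: "T \<noteq> {}"
    and T: "\<And>f. f \<in> T \<Longrightarrow> (\<exists>n. dom f = {..<n}) \<and> ran f \<subseteq> A"
    and shift: "\<And>f x. f \<in> T \<Longrightarrow> x \<in> successors T f \<Longrightarrow>
                  successors T (extend f x) \<subseteq> left_shift x (successors T f)"
    and inF: "\<And>F. finite F \<Longrightarrow> F \<noteq> {} \<Longrightarrow> F \<subseteq> T \<Longrightarrow> (\<Inter>f\<in>F. successors T f) \<in> \<F>"
  shows "essential_set \<F> A"
proof -
  define \<P> where "\<P> = {F. finite F \<and> F \<noteq> {} \<and> F \<subseteq> T}"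
  define B where "B F = (\<Inter>f\<in>F. successors T f)" for F
  have succ_A: "successors T f \<subseteq> A" for f
  proof
    fix x assume "x \<in> successors T f"
    then have "ran (extend f x) \<subseteq> A" using T by (auto simp: successors_def)
    moreover have "x \<in> ran (extend f x)" by (auto simp: extend_def ran_def)
    ultimately show "x \<in> A" by blast
  qed
  show ?thesis
  proof (rule essential_set_if_shift_directed[OF base])
    obtain f where "f \<in> T" using ne by blast
    then have "{f} \<in> \<P>" by (simp add: \<P>_def)
    then show "B ` \<P> \<noteq> {}" by blast
  next
    fix C assume "C \<in> B ` \<P>"
    then obtain F where F: "F \<in> \<P>" "C = B F" by blast
    then show "C \<in> \<F>" using inF by (auto simp: \<P>_def B_def)
    show "C \<subseteq> A" using F succ_A by (auto simp: \<P>_def B_def)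
    fix x assume x: "x \<in> C"
    let ?G = "(\<lambda>f. extend f x) ` F"
    have "?G \<in> \<P>" using F x by (auto simp: \<P>_def B_def successors_def)
    moreover have "B ?G \<subseteq> left_shift x C"
    proof
      fix y assume y: "y \<in> B ?G"
      have "y \<in> left_shift x (successors T f)" if f: "f \<in> F" for f
        using shift[of f x] y that F x by (auto simp: \<P>_def B_def)
      then show "y \<in> left_shift x C" using F by (auto simp: \<P>_def B_def left_shift_def)
    qed
    ultimately show "\<exists>D\<in>B ` \<P>. D \<subseteq> left_shift x C" by blast
  next
    fix C D assume "C \<in> B ` \<P>" "D \<in> B ` \<P>"
    then obtain F G where "F \<in> \<P>" "G \<in> \<P>" "C = B F" "D = B G" by blast
    then show "\<exists>E\<in>B ` \<P>. E \<subseteq> C \<inter> D"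
      by (intro bexI[of _ "B (F \<union> G)"]) (auto simp: \<P>_def B_def)
  qed
qed

lemma essential_set_of_directed_family:
  assumes base: "family \<F>" "translation_invariant \<F>" "ramsey_property \<F>" "A \<subseteq> NN"
    and dir: "downward_directed I C" and CA: "\<And>i. i \<in> I \<Longrightarrow> C i \<subseteq> A"
    and shift: "\<And>i x. i \<in> I \<Longrightarrow> x \<in> C i \<Longrightarrow> \<exists>j\<in>I. C j \<subseteq> left_shift x (C i)"
    and inF: "\<And>i. i \<in> I \<Longrightarrow> C i \<in> \<F>"
  shows "essential_set \<F> A"
proof (rule essential_set_if_shift_directed[OF base, of "C ` I"])
  show "C ` I \<noteq> {}" using dir by (auto simp: downward_directed_def)
  show "\<exists>E\<in>C ` I. E \<subseteq> X \<inter> Y" if "X \<in> C ` I" "Y \<in> C ` I" for X Y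
  proof -
    obtain i j where ij: "i \<in> I" "j \<in> I" "X = C i" "Y = C j" using \<open>X \<in> _\<close> \<open>Y \<in> _\<close> by auto
    then obtain k where "k \<in> I" "C k \<subseteq> C i \<inter> C j"
      using dir unfolding downward_directed_def by metis
    then show ?thesis using ij by auto
  qed
  show "\<exists>Y\<in>C ` I. Y \<subseteq> left_shift x X" if "X \<in> C ` I" "x \<in> X" for X x
    using shift that by (metis imageE imageI)
qed (use CA inF in auto)

lemma antimono_downward_directed:
  fixes C :: "nat \<Rightarrow> nat set"
  assumes "antimono_on NN C"
  shows "downward_directed NN C"
  unfolding downward_directed_def
proof (intro conjI ballI)
  fix m n :: nat assume "m \<in> NN" "n \<in> NN"
  then show "\<exists>k\<in>NN. C k \<subseteq> C m \<inter> C n"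
    using monotone_onD[OF assms, of m "max m n"] monotone_onD[OF assms, of n "max m n"]
    by (intro bexI[of _ "max m n"]) auto
qed auto

theorem theorem3p3:
  fixes \<F> :: "nat set set" and A :: "nat set"
  assumes "family \<F>"
    and "translation_invariant \<F>"
    and "ramsey_property \<F>"
    and "A \<subseteq> NN"
  shows
    "(essential_set \<F> A \<longleftrightarrow>
        (\<exists>T :: (nat \<rightharpoonup> nat) set. T \<noteq> {} \<and>
           (\<forall>f\<in>T. (\<exists>n. dom f = {..<n}) \<and> ran f \<subseteq> A) \<and>
           (\<forall>f\<in>T. \<forall>x\<in>successors T f.
              successors T (extend f x) \<subseteq> left_shift x (successors T f)) \<and>
           (\<forall>F. finite F \<and> F \<noteq> {} \<and> F \<subseteq> T \<longrightarrow> (\<Inter>f\<in>F. successors T f) \<in> \<F>)))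
     \<and>
     (essential_set \<F> A \<longleftrightarrow>
        (\<exists>(I :: 'i::infinite set) (C :: 'i \<Rightarrow> nat set).
           downward_directed I C \<and> (\<forall>F\<in>I. C F \<subseteq> A) \<and>
           (\<forall>F\<in>I. \<forall>x\<in>C F. \<exists>G\<in>I. C G \<subseteq> left_shift x (C F)) \<and>
           (\<forall>\<G>. finite \<G> \<and> \<G> \<noteq> {} \<and> \<G> \<subseteq> I \<longrightarrow> (\<Inter>F\<in>\<G>. C F) \<in> \<F>)))
     \<and>
     (essential_set \<F> A \<longleftrightarrow>
        (\<exists>C :: nat \<Rightarrow> nat set.
           antimono_on NN C \<and> (\<forall>n\<in>NN. C n \<subseteq> A) \<and>
           (\<forall>n\<in>NN. \<forall>x\<in>C n. \<exists>m\<in>NN. C m \<subseteq> left_shift x (C n)) \<and>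
           (\<forall>n\<in>NN. C n \<in> \<F>)))"
proof -
  have ess: "\<exists>p. p \<in> beta_NN \<and> p = beta_plus p p \<and> A \<in> p \<and> p \<subseteq> \<F>" if "essential_set \<F> A"
    using that by (auto simp: essential_set_def beta_family_def)
  have b: "essential_set \<F> A \<longleftrightarrow>
        (\<exists>T :: (nat \<rightharpoonup> nat) set. T \<noteq> {} \<and>
           (\<forall>f\<in>T. (\<exists>n. dom f = {..<n}) \<and> ran f \<subseteq> A) \<and>
           (\<forall>f\<in>T. \<forall>x\<in>successors T f.
              successors T (extend f x) \<subseteq> left_shift x (successors T f)) \<and>
           (\<forall>F. finite F \<and> F \<noteq> {} \<and> F \<subseteq> T \<longrightarrow> (\<Inter>f\<in>F. successors T f) \<in> \<F>))"
    (is "_ \<longleftrightarrow> (\<exists>T. ?B T)")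
  proof
    assume "essential_set \<F> A"
    then obtain p where p: "p \<in> beta_NN" "p = beta_plus p p" "A \<in> p" "p \<subseteq> \<F>"
      using ess by blast
    obtain T :: "(nat \<rightharpoonup> nat) set" where T: "T \<noteq> {}"
      "\<And>f. f \<in> T \<Longrightarrow> (\<exists>n. dom f = {..<n}) \<and> ran f \<subseteq> A"
      "\<And>f x. f \<in> T \<Longrightarrow> x \<in> successors T f \<Longrightarrow>
         successors T (extend f x) \<subseteq> left_shift x (successors T f)"
      "\<And>F. finite F \<Longrightarrow> F \<noteq> {} \<Longrightarrow> F \<subseteq> T \<Longrightarrow> (\<Inter>f\<in>F. successors T f) \<in> p"
      using tree_of_idempotent[OF p(1-3)] by metis
    have "?B T"
      by (intro conjI ballI allI impI T(1,3) subsetD[OF p(4) T(4)]) (use T(2) in simp_all)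
    then show "\<exists>T. ?B T" by (rule exI[of ?B T])
  next
    assume "\<exists>T. ?B T"
    then obtain T where "?B T" ..
    then show "essential_set \<F> A"
      by (intro essential_set_of_tree[OF assms, of T]) simp_all
  qed
  have d: "essential_set \<F> A \<longleftrightarrow>
        (\<exists>C :: nat \<Rightarrow> nat set.
           antimono_on NN C \<and> (\<forall>n\<in>NN. C n \<subseteq> A) \<and>
           (\<forall>n\<in>NN. \<forall>x\<in>C n. \<exists>m\<in>NN. C m \<subseteq> left_shift x (C n)) \<and>
           (\<forall>n\<in>NN. C n \<in> \<F>))"
    (is "_ \<longleftrightarrow> (\<exists>C. ?D C)")
  proof
    assume "essential_set \<F> A"
    then obtain p where p: "p \<in> beta_NN" "p = beta_plus p p" "A \<in> p" "p \<subseteq> \<F>"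
      using ess by blast
    obtain C :: "nat \<Rightarrow> nat set" where C: "antimono_on NN C" "\<And>n. C n \<subseteq> A"
      "\<And>n x. n \<in> NN \<Longrightarrow> x \<in> C n \<Longrightarrow> \<exists>m\<in>NN. C m \<subseteq> left_shift x (C n)" "\<And>n. C n \<in> p"
      using sequence_of_idempotent[OF p(1-3)] by metis
    have "?D C"
      by (intro conjI ballI C(1,2,3) subsetD[OF p(4) C(4)])
    then show "\<exists>C. ?D C" by (rule exI[of ?D C])
  next
    assume "\<exists>C. ?D C"
    then obtain C where "?D C" ..
    then show "essential_set \<F> A"
      by (intro essential_set_of_directed_family[OF assms, of NN C] antimono_downward_directed) blast+
  qed
  have c: "essential_set \<F> A \<longleftrightarrow>
        (\<exists>(I :: 'i set) (C :: 'i \<Rightarrow> nat set).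
           downward_directed I C \<and> (\<forall>F\<in>I. C F \<subseteq> A) \<and>
           (\<forall>F\<in>I. \<forall>x\<in>C F. \<exists>G\<in>I. C G \<subseteq> left_shift x (C F)) \<and>
           (\<forall>\<G>. finite \<G> \<and> \<G> \<noteq> {} \<and> \<G> \<subseteq> I \<longrightarrow> (\<Inter>F\<in>\<G>. C F) \<in> \<F>))"
    (is "_ \<longleftrightarrow> (\<exists>I C. ?C I C)")
  proof
    assume "essential_set \<F> A"
    then obtain p where p: "p \<in> beta_NN" "p = beta_plus p p" "A \<in> p" "p \<subseteq> \<F>"
      using ess by blast
    obtain C :: "nat \<Rightarrow> nat set" where C: "antimono_on NN C" "\<And>n. C n \<subseteq> A"
      "\<And>n x. n \<in> NN \<Longrightarrow> x \<in> C n \<Longrightarrow> \<exists>m\<in>NN. C m \<subseteq> left_shift x (C n)" "\<And>n. C n \<in> p"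
      using sequence_of_idempotent[OF p(1-3)] by metis
    \<comment> \<open>The sequence becomes a family indexed by \<open>'i\<close> along an injection \<open>\<nat> \<rightarrow> 'i\<close>.\<close>
    obtain e :: "nat \<Rightarrow> 'i" where e: "inj e"
      using infinite_countable_subset[OF infinite_UNIV] by blast
    define C' where "C' i = C (inv e i)" for i
    have C': "C' (e n) = C n" for n using e by (simp add: C'_def)
    have "(\<Inter>i\<in>\<G>. C' i) \<in> \<F>" if G: "finite \<G>" "\<G> \<noteq> {}" "\<G> \<subseteq> e ` NN" for \<G>
    proof -
      have sub: "C' ` \<G> \<subseteq> p" using G(3) C(4) C' by auto
      then have "NN \<inter> (\<Inter>i\<in>\<G>. C' i) \<in> p" using G(1) by (intro beta_NN_Inter[OF p(1)]) auto
      moreover have "(\<Inter>i\<in>\<G>. C' i) \<subseteq> NN" using sub G(2) beta_NN_subset[OF p(1)] by blast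
      ultimately show ?thesis using p(4) by (auto simp: Int_absorb1)
    qed
    moreover have "downward_directed (e ` NN) C'"
      using antimono_downward_directed[OF C(1)] by (simp add: downward_directed_def C')
    ultimately have "?C (e ` NN) C'" using C by (auto simp: C')
    then show "\<exists>I C. ?C I C" by blast
  next
    assume "\<exists>I C. ?C I C"
    then obtain I C where IC: "?C I C" by blast
    have "C i \<in> \<F>" if "i \<in> I" for i
    proof -
      have "(\<Inter>F\<in>{i}. C F) \<in> \<F>" using IC that by blast
      then show ?thesis by simp
    qed
    then show "essential_set \<F> A"
      using IC by (intro essential_set_of_directed_family[OF assms, of I C]) blast+
  qed
  show ?thesis by (intro conjI) (fact b, fact c, fact d)
qed

end
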